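(* Let $r$ be an odd integer and let $n$ be a positive integer. Then \[ L_{3r}\sum_{k=1}^n F_{2rk}^3= \begin{cases} F_{rn}^2L_{rn+r}^2\left(L_{rn}F_{rn+r}+F_r\right) & \text{if $n$ is even,}\\ L_{rn}^2F_{rn+r}^2\left(F_{rn}L_{rn+r}+F_r\right) & \text{if $n$ is odd.} \end{cases} \]
   Context: The Fibonacci numbers $F_m$ and Lucas numbers $L_m$ are defined for all $m\in\mathbb{Z}$ by $F_m=F_{m-1}+F_{m-2}$, $F_0=0$, $F_1=1$, and $L_m=L_{m-1}+L_{m-2}$, $L_0=2$, $L_1=1$; in particular $F_{-m}=(-1)^{m-1}F_m$ and $L_{-m}=(-1)^mL_m$. *)

theory Defs
  imports "HOL-Number_Theory.Fib"
begin

fun lucas :: "nat \<Rightarrow> nat" where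
  "lucas 0 = 2"
| "lucas (Suc 0) = 1"
| "lucas (Suc (Suc m)) = lucas (Suc m) + lucas m"

text \<open>
  Fibonacci and Lucas numbers with arbitrary integer index. The values at negative indices
  are those forced by running the recurrence backwards: \<open>F\<^sub>-\<^sub>m = (-1)\<^sup>m\<^sup>-\<^sup>1 F\<^sub>m\<close> and
  \<open>L\<^sub>-\<^sub>m = (-1)\<^sup>m L\<^sub>m\<close>. The lemmas below show that these are exactly the solutions on all
  of the integers of the recurrence with the given initial values.
\<close>

definition fib_int :: "int \<Rightarrow> int" where
  "fib_int m = (if 0 \<le> m then int (fib (nat m))
                else (-1) ^ nat (- m - 1) * int (fib (nat (- m))))"

definition lucas_int :: "int \<Rightarrow> int" where
  "lucas_int m = (if 0 \<le> m then int (lucas (nat m))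
                  else (-1) ^ nat (- m) * int (lucas (nat (- m))))"

lemma fib_int_0: "fib_int 0 = 0"
  and fib_int_1: "fib_int 1 = 1"
  by (simp_all add: fib_int_def)

lemma lucas_int_0: "lucas_int 0 = 2"
  and lucas_int_1: "lucas_int 1 = 1"
  by (simp_all add: lucas_int_def)

lemma index_cases:
  fixes m :: int
  obtains (nonneg) j where "m = int j + 2" | (one) "m = 1" | (neg) j where "m = - int j"
proof -
  consider "m \<ge> 2" | "m = 1" | "m \<le> 0" by linarith
  then show thesis
  proof cases
    case 1
    then show thesis using nonneg[of "nat (m - 2)"] by simp
  next
    case 2
    then show thesis by (rule one)
  next
    case 3
    then show thesis using neg[of "nat (- m)"] by simp
  qed
qed

lemma fib_int_of_nat: "fib_int (int j) = int (fib j)"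
  and fib_int_minus: "fib_int (- int j) = - ((-1) ^ j) * int (fib j)"
proof -
  show "fib_int (int j) = int (fib j)" by (simp add: fib_int_def)
  show "fib_int (- int j) = - ((-1) ^ j) * int (fib j)"
  proof (cases j)
    case 0
    then show ?thesis by (simp add: fib_int_def)
  next
    case (Suc i)
    then have "nat (- (- int j) - 1) = i" "nat (- (- int j)) = j" "\<not> 0 \<le> - int j" by linarith+
    with Suc show ?thesis unfolding fib_int_def by (simp del: fib.simps)
  qed
qed

lemma lucas_int_of_nat: "lucas_int (int j) = int (lucas j)"
  and lucas_int_minus: "lucas_int (- int j) = (-1) ^ j * int (lucas j)"
  by (cases j; simp add: lucas_int_def del: lucas.simps of_nat_Suc)+

lemma fib_int_rec: "fib_int m = fib_int (m - 1) + fib_int (m - 2)"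
proof (cases m rule: index_cases)
  case (nonneg j)
  then have "m = int (Suc (Suc j))" "m - 1 = int (Suc j)" "m - 2 = int j" by linarith+
  then show ?thesis by (simp only: fib_int_of_nat fib.simps of_nat_add)
next
  case one
  then show ?thesis by (simp add: fib_int_def)
next
  case (neg j)
  then have "m - 1 = - int (Suc j)" "m - 2 = - int (Suc (Suc j))" by linarith+
  with neg have "fib_int m = - ((-1) ^ j) * int (fib j)"
    "fib_int (m - 1) = (-1) ^ j * int (fib (Suc j))"
    "fib_int (m - 2) = - ((-1) ^ j) * int (fib (Suc (Suc j)))"
    by (simp_all only: fib_int_minus power_Suc)
  then show ?thesis by (simp add: algebra_simps)
qed

lemma lucas_int_rec: "lucas_int m = lucas_int (m - 1) + lucas_int (m - 2)"
proof (cases m rule: index_cases)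
  case (nonneg j)
  then have "m = int (Suc (Suc j))" "m - 1 = int (Suc j)" "m - 2 = int j" by linarith+
  then show ?thesis by (simp only: lucas_int_of_nat lucas.simps of_nat_add)
next
  case one
  then show ?thesis by (simp add: lucas_int_def)
next
  case (neg j)
  then have "m - 1 = - int (Suc j)" "m - 2 = - int (Suc (Suc j))" by linarith+
  with neg have "lucas_int m = (-1) ^ j * int (lucas j)"
    "lucas_int (m - 1) = - ((-1) ^ j) * int (lucas (Suc j))"
    "lucas_int (m - 2) = (-1) ^ j * int (lucas (Suc (Suc j)))"
    by (simp_all only: lucas_int_minus power_Suc)
  then show ?thesis by (simp add: algebra_simps)
qed

lemma two_sided_rec_unique:
  fixes f g :: "int \<Rightarrow> int"
  assumes f: "\<And>m. f m = f (m - 1) + f (m - 2)" and g: "\<And>m. g m = g (m - 1) + g (m - 2)"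
    and "f 0 = g 0" and "f 1 = g 1"
  shows "f = g"
proof
  fix m :: int
  have "f m = g m \<and> f (m + 1) = g (m + 1)"
  proof (induction m rule: int_induct[where k = 0])
    case base
    show ?case using assms(3,4) by simp
  next
    case (step1 i)
    then show ?case using f[of "i + 2"] g[of "i + 2"] by (simp add: algebra_simps)
  next
    case (step2 i)
    then show ?case using f[of "i + 1"] g[of "i + 1"] by (simp add: algebra_simps)
  qed
  then show "f m = g m" by simp
qed

end

theory Submission
  imports Defs
begin

text \<open>
  Both cases of the right-hand side are the same cubic in \<open>S = F\<^bsub>2rn+r\<^esub>\<close>. With \<open>m = rn\<close> the
  products \<open>F\<^sub>m L\<^bsub>m+r\<^esub>\<close> and \<open>L\<^sub>m F\<^bsub>m+r\<^esub>\<close> have sum \<open>2S\<close> and differ by \<open>2(-1)\<^sup>m F\<^sub>r\<close>, so they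
  are \<open>S - F\<^sub>r\<close> and \<open>S + F\<^sub>r\<close>, in an order that depends on the parity of \<open>m\<close>, which is that of
  \<open>n\<close>. The case distinction puts the square on \<open>S - F\<^sub>r\<close> each time, and the right-hand side is
  \<open>(S - F\<^sub>r)\<^sup>2 (S + 2 F\<^sub>r)\<close>.

  In that form the identity telescopes. The cubic vanishes for \<open>n = 0\<close>, where \<open>S = F\<^sub>r\<close>.
  Passing from \<open>n - 1\<close> to \<open>n\<close> replaces \<open>F\<^bsub>c-r\<^esub>\<close> by \<open>F\<^bsub>c+r\<^esub>\<close> with \<open>c = 2rn\<close>; these are
  \<open>(L\<^sub>c F\<^sub>r - F\<^sub>c L\<^sub>r) / 2\<close> and \<open>(L\<^sub>c F\<^sub>r + F\<^sub>c L\<^sub>r) / 2\<close>. Eliminating \<open>L\<^sub>c\<^sup>2\<close> and \<open>F\<^sub>r\<^sup>2\<close> by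
  \<open>L\<^sup>2 - 5 F\<^sup>2 = \<plusminus>4\<close> leaves the increment \<open>(L\<^sub>r\<^sup>3 + 3 L\<^sub>r) F\<^sub>c\<^sup>3 = L\<^bsub>3r\<^esub> F\<^sub>c\<^sup>3\<close>.
\<close>

lemma lucas_int_eq_fib_int: "lucas_int m = 2 * fib_int (m + 1) - fib_int m"
proof -
  have "lucas_int = (\<lambda>m. 2 * fib_int (m + 1) - fib_int m)"
  proof (rule two_sided_rec_unique)
    fix m
    show "2 * fib_int (m + 1) - fib_int m =
        2 * fib_int (m - 1 + 1) - fib_int (m - 1) + (2 * fib_int (m - 2 + 1) - fib_int (m - 2))"
      using fib_int_rec[of m] fib_int_rec[of "m + 1"] by (simp add: algebra_simps)
  qed (use fib_int_rec[of 2] in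
      \<open>simp_all add: lucas_int_rec[symmetric] fib_int_0 fib_int_1 lucas_int_0 lucas_int_1\<close>)
  then show ?thesis by metis
qed

text \<open>For fixed \<open>m\<close> both sides solve the Fibonacci recurrence in \<open>k\<close>.\<close>

lemma fib_int_add: "2 * fib_int (m + k) = fib_int m * lucas_int k + lucas_int m * fib_int k"
proof -
  have "(\<lambda>k. 2 * fib_int (m + k)) = (\<lambda>k. fib_int m * lucas_int k + lucas_int m * fib_int k)"
  proof (rule two_sided_rec_unique)
    fix k
    show "2 * fib_int (m + k) = 2 * fib_int (m + (k - 1)) + 2 * fib_int (m + (k - 2))"
      using fib_int_rec[of "m + k"] by (simp add: algebra_simps)
    show "fib_int m * lucas_int k + lucas_int m * fib_int k =
        fib_int m * lucas_int (k - 1) + lucas_int m * fib_int (k - 1) +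
        (fib_int m * lucas_int (k - 2) + lucas_int m * fib_int (k - 2))"
      using fib_int_rec[of k] lucas_int_rec[of k] by (simp add: distrib_left)
  qed (simp_all add: fib_int_0 fib_int_1 lucas_int_0 lucas_int_1 lucas_int_eq_fib_int[of m])
  then show ?thesis by meson
qed

lemma lucas_int_add: "2 * lucas_int (m + k) = lucas_int m * lucas_int k + 5 * fib_int m * fib_int k"
proof -
  have "(\<lambda>k. 2 * lucas_int (m + k)) =
      (\<lambda>k. lucas_int m * lucas_int k + 5 * fib_int m * fib_int k)"
  proof (rule two_sided_rec_unique)
    fix k
    show "2 * lucas_int (m + k) = 2 * lucas_int (m + (k - 1)) + 2 * lucas_int (m + (k - 2))"
      using lucas_int_rec[of "m + k"] by (simp add: algebra_simps)
    show "lucas_int m * lucas_int k + 5 * fib_int m * fib_int k =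
        lucas_int m * lucas_int (k - 1) + 5 * fib_int m * fib_int (k - 1) +
        (lucas_int m * lucas_int (k - 2) + 5 * fib_int m * fib_int (k - 2))"
      using fib_int_rec[of k] lucas_int_rec[of k] by (simp add: distrib_left)
  next
    show "2 * lucas_int (m + 1) = lucas_int m * lucas_int 1 + 5 * fib_int m * fib_int 1"
      using fib_int_rec[of "m + 2"] lucas_int_eq_fib_int[of m] lucas_int_eq_fib_int[of "m + 1"]
      by (simp add: fib_int_1 lucas_int_1 algebra_simps)
  qed (simp_all add: fib_int_0 lucas_int_0)
  then show ?thesis by meson
qed

text \<open>
  Up to the factor 4 this is the norm of the \<open>m\<close>-th power of the golden ratio,
  hence \<open>(-1)\<^sup>m\<close>; equivalently, it changes sign when \<open>m\<close> grows by one.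
\<close>

lemma lucas_int_fib_int_norm:
  "lucas_int m ^ 2 - 5 * fib_int m ^ 2 = (if even m then 4 else - 4)"
proof (induction m rule: int_induct[where k = 0])
  case base
  show ?case by (simp add: fib_int_0 lucas_int_0)
next
  have flip: "lucas_int (i + 1) ^ 2 - 5 * fib_int (i + 1) ^ 2 =
      - (lucas_int i ^ 2 - 5 * fib_int i ^ 2)" for i
  proof -
    have "2 * fib_int (i + 1) = fib_int i + lucas_int i"
      "2 * lucas_int (i + 1) = lucas_int i + 5 * fib_int i"
      using fib_int_add[of i 1] lucas_int_add[of i 1] by (simp_all add: fib_int_1 lucas_int_1)
    then have "4 * (lucas_int (i + 1) ^ 2 - 5 * fib_int (i + 1) ^ 2) =
        4 * - (lucas_int i ^ 2 - 5 * fib_int i ^ 2)"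
      by algebra
    then show ?thesis by simp
  qed
  {
    case (step1 i)
    then show ?case using flip[of i] by (simp split: if_splits)
  next
    case (step2 i)
    then show ?case using flip[of "i - 1"] by (simp split: if_splits)
  }
qed

lemma fib_int_diff_odd:
  assumes "odd k"
  shows "2 * fib_int (m - k) = lucas_int m * fib_int k - fib_int m * lucas_int k"
proof -
  have "2 * fib_int m = fib_int (m - k) * lucas_int k + lucas_int (m - k) * fib_int k"
    "2 * lucas_int m = lucas_int (m - k) * lucas_int k + 5 * fib_int (m - k) * fib_int k"
    using fib_int_add[of "m - k" k] lucas_int_add[of "m - k" k] by simp_all
  moreover have "lucas_int k ^ 2 - 5 * fib_int k ^ 2 = - 4"
    using assms by (simp add: lucas_int_fib_int_norm)
  ultimately have "2 * (2 * fib_int (m - k)) =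
      2 * (lucas_int m * fib_int k - fib_int m * lucas_int k)"
    by algebra
  then show ?thesis by simp
qed

lemma lucas_int_triple_odd:
  assumes "odd r"
  shows "lucas_int (3 * r) = lucas_int r ^ 3 + 3 * lucas_int r"
proof -
  have "2 * fib_int (2 * r) = 2 * fib_int r * lucas_int r"
    "2 * lucas_int (2 * r) = lucas_int r ^ 2 + 5 * fib_int r ^ 2"
    using fib_int_add[of r r] lucas_int_add[of r r] by (simp_all add: power2_eq_square)
  moreover have "2 * lucas_int (3 * r) =
      lucas_int (2 * r) * lucas_int r + 5 * fib_int (2 * r) * fib_int r"
    using lucas_int_add[of "2 * r" r] by simp
  moreover have "lucas_int r ^ 2 - 5 * fib_int r ^ 2 = - 4"
    using assms by (simp add: lucas_int_fib_int_norm)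
  ultimately have "4 * lucas_int (3 * r) = 4 * (lucas_int r ^ 3 + 3 * lucas_int r)"
    by algebra
  then show ?thesis by simp
qed

text \<open>
  The products \<open>F\<^sub>m L\<^bsub>m+r\<^esub>\<close> and \<open>L\<^sub>m F\<^bsub>m+r\<^esub>\<close> are recovered from their sum, given by the addition
  formula, and their difference, in which expanding the index \<open>m + r\<close> leaves
  \<open>(L\<^sub>m\<^sup>2 - 5 F\<^sub>m\<^sup>2) F\<^sub>r / 2\<close>.
\<close>

lemma fib_int_lucas_int_products:
  fixes m r :: int
  defines "e \<equiv> (if even m then 1 else - 1)"
  shows "fib_int m * lucas_int (m + r) = fib_int (2 * m + r) - e * fib_int r" (is ?FL)
    and "lucas_int m * fib_int (m + r) = fib_int (2 * m + r) + e * fib_int r" (is ?LF)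
proof -
  have sum: "2 * fib_int (2 * m + r) =
      fib_int m * lucas_int (m + r) + lucas_int m * fib_int (m + r)"
    using fib_int_add[of m "m + r"] by (simp add: algebra_simps)
  have "lucas_int m ^ 2 - 5 * fib_int m ^ 2 = 4 * e"
    by (simp add: lucas_int_fib_int_norm e_def)
  with fib_int_add[of m r] lucas_int_add[of m r]
  have "2 * (lucas_int m * fib_int (m + r) - fib_int m * lucas_int (m + r)) =
      2 * (2 * e * fib_int r)"
    by algebra
  with sum show ?FL ?LF by simp_all
qed

text \<open>
  The polynomial \<open>P(x) = (x - p)\<^sup>2 (x + 2p) = x\<^sup>3 - 3 p\<^sup>2 x + 2 p\<^sup>3\<close> with \<open>p = F\<^sub>r\<close> has no
  quadratic term, so \<open>P(s) - P(t) = (s - t) (s\<^sup>2 + s t + t\<^sup>2 - 3 p\<^sup>2)\<close>. For \<open>s = F\<^bsub>c+r\<^esub>\<close> and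
  \<open>t = F\<^bsub>c-r\<^esub>\<close> the first factor is \<open>F\<^sub>c L\<^sub>r\<close>, and the norm equations turn the second into
  \<open>F\<^sub>c\<^sup>2 (L\<^sub>r\<^sup>2 + 3)\<close>.
\<close>

lemma cubic_increment:
  assumes "odd r" and "even c"
  shows "(fib_int (c + r) - fib_int r) ^ 2 * (fib_int (c + r) + 2 * fib_int r) =
    (fib_int (c - r) - fib_int r) ^ 2 * (fib_int (c - r) + 2 * fib_int r) +
    lucas_int (3 * r) * fib_int c ^ 3"
proof -
  define f l p q where "f = fib_int c" "l = lucas_int c" "p = fib_int r" "q = lucas_int r"
  define s t where "s = fib_int (c + r)" "t = fib_int (c - r)"
  note defs = this f_l_p_q_def
  have "2 * s = f * q + l * p" "2 * t = l * p - f * q"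
    using fib_int_add[of c r] fib_int_diff_odd[OF assms(1), of c] by (simp_all add: defs)
  then have diff: "s - t = f * q"
    and squares: "4 * (s ^ 2 + s * t + t ^ 2) = f ^ 2 * q ^ 2 + 3 * l ^ 2 * p ^ 2"
    by (simp, algebra)
  have "l ^ 2 = 5 * f ^ 2 + 4" "5 * p ^ 2 = q ^ 2 + 4"
    using lucas_int_fib_int_norm[of c] lucas_int_fib_int_norm[of r] assms by (simp_all add: defs)
  with squares have "4 * (s ^ 2 + s * t + t ^ 2 - 3 * p ^ 2) = 4 * (f ^ 2 * (q ^ 2 + 3))"
    by algebra
  then have "s ^ 2 + s * t + t ^ 2 - 3 * p ^ 2 = f ^ 2 * (q ^ 2 + 3)" by simp
  with diff have "(s - p) ^ 2 * (s + 2 * p) = (t - p) ^ 2 * (t + 2 * p) + (q ^ 3 + 3 * q) * f ^ 3"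
    by algebra
  then show ?thesis by (simp add: defs lucas_int_triple_odd[OF assms(1)])
qed

lemma sum_fib_int_cubes:
  assumes "odd r"
  shows "lucas_int (3 * r) * (\<Sum>k=1..n. fib_int (2 * r * int k) ^ 3) =
    (fib_int (2 * (r * int n) + r) - fib_int r) ^ 2 *
    (fib_int (2 * (r * int n) + r) + 2 * fib_int r)"
proof (induction n)
  case 0
  show ?case by simp
next
  case (Suc n)
  define c where "c = 2 * r * int (Suc n)"
  have "2 * (r * int n) + r = c - r" "2 * (r * int (Suc n)) + r = c + r"
    by (simp_all add: c_def algebra_simps)
  moreover have "(\<Sum>k=1..Suc n. fib_int (2 * r * int k) ^ 3) =
      (\<Sum>k=1..n. fib_int (2 * r * int k) ^ 3) + fib_int c ^ 3"
    by (simp add: c_def)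
  moreover have "even c" by (simp add: c_def)
  ultimately show ?case
    using Suc cubic_increment[OF assms, of c] by (simp only: distrib_left)
qed

theorem theorem3p3:
  fixes r :: int and n :: nat
  assumes "odd r" and "n > 0"
  shows "lucas_int (3 * r) * (\<Sum>k=1..n. fib_int (2 * r * int k) ^ 3) =
    (if even n then
       fib_int (r * int n) ^ 2 * lucas_int (r * int n + r) ^ 2 *
         (lucas_int (r * int n) * fib_int (r * int n + r) + fib_int r)
     else
       lucas_int (r * int n) ^ 2 * fib_int (r * int n + r) ^ 2 *
         (fib_int (r * int n) * lucas_int (r * int n + r) + fib_int r))"
  unfolding sum_fib_int_cubes[OF assms(1)] power_mult_distrib[symmetric]
  using assms(1) by (simp add: fib_int_lucas_int_products)

end
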